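(* Let $n\ge1$ be an integer and $Q=2n+2$. Let $M:\mathbb R_+\times\mathbb R_+\times\mathbb R_+\to\mathbb R$ satisfy $$0<M(t,\cdot,\cdot)\le C_1t^\beta\quad\text{for all }t>0,$$ for some constant $C_1$ and some $0\le\beta<1$. If $$1<p<p_c=1+\frac{2-2\beta}{Q+2\beta},$$ then the problem $$\begin{cases}u_t-M\left(t,\int_{\mathbb H^n}|\nabla_{\mathbb H}u|^2dx,\int_{\mathbb H^n}|\Delta_{\mathbb H}u|^2dx\right)\Delta_{\mathbb H}u=|u|^p,\\ u(x,0)=u_0(x)\ge0,\quad x\in\mathbb H^n,\end{cases}$$ admits no global (i.e. on $\mathbb H^n\times(0,\infty)$) non-trivial weak solution.
   Context: $\mathbb R_+=[0,\infty)$. The Heisenberg group $\mathbb H^n$ is $\mathbb R^{2n+1}$ with points $x=(\xi,\tilde\xi,\tau)$, $\xi,\tilde\xi\in\mathbb R^n$, $\tau\in\mathbb R$, equipped with the vector fields $X_i=\partial_{\xi_i}+2\tilde\xi_i\partial_\tau$, $Y_i=\partial_{\tilde\xi_i}-2\xi_i\partial_\tau$ ($i=1,\dots,n$) and with Lebesgue measure $dx$; its homogeneous dimension is $Q=2n+2$ (dilations $\delta_\lambda(x)=(\lambda\xi,\lambda\tilde\xi,\lambda^2\tau)$). The horizontal gradient is $\nabla_{\mathbb H}=(X_1,\dots,X_n,Y_1,\dots,Y_n)$ and the Kohn-Laplacian is $\Delta_{\mathbb H}=\sum_{i=1}^n(X_i^2+Y_i^2)$; both act in the variable $x$ only. $S^2_2(\mathbb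 H^n)=\{u: u\in L^2(\mathbb H^n),\ |\nabla_{\mathbb H}u|\in L^2(\mathbb H^n),\ |\Delta_{\mathbb H}u|\in L^2(\mathbb H^n)\}$ (derivatives in the distributional sense). Let $\Omega=\mathbb H^n\times(0,\infty)$. Definition. $u$ is a (global) weak solution with initial data $0\le u_0\in L^1(\mathbb H^n)$ if $u\in C^1((0,\infty);S^2_2(\mathbb H^n))\cap L^p_{loc}(\Omega)$ and $$\int_\Omega|u|^p\varphi\,dxdt+\int_{\mathbb H^n}u_0(x)\varphi(x,0)\,dx=-\int_\Omega u\varphi_t\,dxdt-\int_\Omega M\left(t,\int_{\mathbb H^n}|\nabla_{\mathbb H}u|^2dx,\int_{\mathbb H^n}|\Delta_{\mathbb H}u|^2dx\right)u\,\Delta_{\mathbb H}\varphi\,dxdt,$$ with all integrals absolutely convergent, for every test function $\varphi\ge0$ of class $C^{2,1}_{x,t}$ (twice continuously differentiable in $x$, once in $t$, up to $t=0$) with compact support in $\mathbb H^n\times[0,\infty)$. Non-trivial means not almost everywhere zero in $\Omega$. *)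

theory Defs
  imports "HOL-Analysis.Analysis"
begin

text \<open>Points of the Heisenberg group are triples (xi, eta, tau), with eta standing for the
  second group of n horizontal coordinates and n = CARD('n). The product type carries the Euclidean
  structure of dimension 2 n + 1; \<^term>\<open>lebesgue\<close> is its Lebesgue measure.\<close>

type_synonym 'n heisenberg = "(real ^ 'n) \<times> (real ^ 'n) \<times> real"

definition partial :: "'a::euclidean_space \<Rightarrow> ('a \<Rightarrow> real) \<Rightarrow> 'a \<Rightarrow> real" where
  "partial b f x = frechet_derivative f (at x) b"

primrec C_times :: "nat \<Rightarrow> ('a::euclidean_space \<Rightarrow> real) \<Rightarrow> bool" where
  "C_times 0 f \<longleftrightarrow> continuous_on UNIV f"
| "C_times (Suc k) f \<longleftrightarrow>
     (\<forall>x. f differentiable (at x)) \<and> (\<forall>b\<in>Basis. C_times k (partial b f))"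

definition X_field :: "'n::finite \<Rightarrow> ('n heisenberg \<Rightarrow> real) \<Rightarrow> 'n heisenberg \<Rightarrow> real" where
  "X_field i f = (\<lambda>(\<xi>, \<eta>, \<tau>).
     partial (axis i 1, 0, 0) f (\<xi>, \<eta>, \<tau>) + 2 * \<eta> $ i * partial (0, 0, 1) f (\<xi>, \<eta>, \<tau>))"

definition Y_field :: "'n::finite \<Rightarrow> ('n heisenberg \<Rightarrow> real) \<Rightarrow> 'n heisenberg \<Rightarrow> real" where
  "Y_field i f = (\<lambda>(\<xi>, \<eta>, \<tau>).
     partial (0, axis i 1, 0) f (\<xi>, \<eta>, \<tau>) - 2 * \<xi> $ i * partial (0, 0, 1) f (\<xi>, \<eta>, \<tau>))"

definition kohn_laplacian :: "('n::finite heisenberg \<Rightarrow> real) \<Rightarrow> 'n heisenberg \<Rightarrow> real" where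
  "kohn_laplacian f x =
     (\<Sum>i\<in>UNIV. X_field i (X_field i f) x + Y_field i (Y_field i f) x)"

definition locally_Lp :: "real \<Rightarrow> 'a::euclidean_space set \<Rightarrow> ('a \<Rightarrow> real) \<Rightarrow> bool" where
  "locally_Lp p S f \<longleftrightarrow> set_borel_measurable lebesgue S f \<and>
     (\<forall>K. compact K \<and> K \<subseteq> S \<longrightarrow> set_integrable lebesgue K (\<lambda>x. \<bar>f x\<bar> powr p))"

definition L2 :: "('a::euclidean_space \<Rightarrow> real) \<Rightarrow> bool" where
  "L2 f \<longleftrightarrow> f \<in> borel_measurable lebesgue \<and> integrable lebesgue (\<lambda>x. (f x)\<^sup>2)"

definition test_function :: "('a::euclidean_space \<Rightarrow> real) \<Rightarrow> bool" where
  "test_function \<phi> \<longleftrightarrow> (\<forall>k. C_times k \<phi>) \<and> compact (closure {x. \<phi> x \<noteq> 0})"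

text \<open>\<open>g\<close> represents the distribution \<open>D u\<close>, where \<open>Dt\<close> is the formal transpose of the
  differential operator \<open>D\<close>.\<close>

definition represents ::
  "(('a::euclidean_space \<Rightarrow> real) \<Rightarrow> 'a \<Rightarrow> real) \<Rightarrow> ('a \<Rightarrow> real) \<Rightarrow> ('a \<Rightarrow> real) \<Rightarrow> bool" where
  "represents Dt u g \<longleftrightarrow> locally_Lp 1 UNIV u \<and> locally_Lp 1 UNIV g \<and>
     (\<forall>\<phi>. test_function \<phi> \<longrightarrow>
        (\<integral>x. g x * \<phi> x \<partial>lebesgue) = (\<integral>x. u x * Dt \<phi> x \<partial>lebesgue))"

text \<open>\<open>X_i\<close> and \<open>Y_i\<close> are divergence free, so their transposes are \<open>- X_i\<close> and \<open>- Y_i\<close>,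
  and the Kohn-Laplacian is its own transpose.\<close>

definition is_weak_X :: "'n::finite \<Rightarrow> ('n heisenberg \<Rightarrow> real) \<Rightarrow> ('n heisenberg \<Rightarrow> real) \<Rightarrow> bool" where
  "is_weak_X i = represents (\<lambda>\<phi> x. - X_field i \<phi> x)"

definition is_weak_Y :: "'n::finite \<Rightarrow> ('n heisenberg \<Rightarrow> real) \<Rightarrow> ('n heisenberg \<Rightarrow> real) \<Rightarrow> bool" where
  "is_weak_Y i = represents (\<lambda>\<phi> x. - Y_field i \<phi> x)"

definition is_weak_laplacian :: "('n::finite heisenberg \<Rightarrow> real) \<Rightarrow> ('n heisenberg \<Rightarrow> real) \<Rightarrow> bool" where
  "is_weak_laplacian = represents kohn_laplacian"

text \<open>The representing functions are unique up to null sets; a representative is chosen.\<close>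

definition weak_grad :: "('n::finite heisenberg \<Rightarrow> real) \<Rightarrow> 'n heisenberg \<Rightarrow> (real ^ 'n) \<times> (real ^ 'n)" where
  "weak_grad u x = (\<chi> i. (SOME g. is_weak_X i u g) x, \<chi> i. (SOME g. is_weak_Y i u g) x)"

definition weak_laplacian :: "('n::finite heisenberg \<Rightarrow> real) \<Rightarrow> 'n heisenberg \<Rightarrow> real" where
  "weak_laplacian u = (SOME g. is_weak_laplacian u g)"

definition S22 :: "('n::finite heisenberg \<Rightarrow> real) \<Rightarrow> bool" where
  "S22 u \<longleftrightarrow> L2 u \<and>
     (\<forall>i. (\<exists>g. is_weak_X i u g) \<and> (\<exists>g. is_weak_Y i u g)) \<and> L2 (\<lambda>x. norm (weak_grad u x)) \<and>
     (\<exists>g. is_weak_laplacian u g) \<and> L2 (\<lambda>x. \<bar>weak_laplacian u x\<bar>)"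

definition grad_energy :: "('n::finite heisenberg \<Rightarrow> real) \<Rightarrow> real" where
  "grad_energy u = (\<integral>x. (norm (weak_grad u x))\<^sup>2 \<partial>lebesgue)"

definition laplacian_energy :: "('n::finite heisenberg \<Rightarrow> real) \<Rightarrow> real" where
  "laplacian_energy u = (\<integral>x. \<bar>weak_laplacian u x\<bar>\<^sup>2 \<partial>lebesgue)"

definition S22_norm :: "('n::finite heisenberg \<Rightarrow> real) \<Rightarrow> real" where
  "S22_norm u = sqrt ((\<integral>x. (u x)\<^sup>2 \<partial>lebesgue) + grad_energy u + laplacian_energy u)"

text \<open>Continuous differentiability of \<open>(0,\<infinity>) \<rightarrow> S22\<close>, where \<open>S22\<close> carries its Hilbert norm.\<close>

definition C1_S22 :: "(real \<Rightarrow> 'n::finite heisenberg \<Rightarrow> real) \<Rightarrow> bool" where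
  "C1_S22 u \<longleftrightarrow> (\<exists>v. \<forall>t>0. S22 (u t) \<and> S22 (v t) \<and>
     ((\<lambda>h. S22_norm (\<lambda>x. (u (t + h) x - u t x) / h - v t x)) \<longlongrightarrow> 0) (at 0) \<and>
     ((\<lambda>s. S22_norm (\<lambda>x. v s x - v t x)) \<longlongrightarrow> 0) (at t))"

text \<open>The derivative is taken on \<open>[0,\<infinity>)\<close>, one-sided at \<open>t = 0\<close>.\<close>

definition time_deriv :: "('a \<times> real \<Rightarrow> real) \<Rightarrow> 'a \<times> real \<Rightarrow> real" where
  "time_deriv \<phi> = (\<lambda>(x, t). vector_derivative (\<lambda>s. \<phi> (x, s)) (at t within {0..}))"

text \<open>Functions of class \<open>C\<^sup>2\<close> in \<open>x\<close> and \<open>C\<^sup>1\<close> in \<open>t\<close> up to \<open>t = 0\<close>, all derivatives being jointly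
  continuous, with compact support in the closed half space; values at \<open>t < 0\<close> are irrelevant.\<close>

definition test_function_21 :: "('a::euclidean_space \<times> real \<Rightarrow> real) \<Rightarrow> bool" where
  "test_function_21 \<phi> \<longleftrightarrow>
     (\<forall>t\<ge>0. C_times 2 (\<lambda>x. \<phi> (x, t))) \<and>
     (\<forall>x. \<forall>t\<ge>0. (\<lambda>s. \<phi> (x, s)) differentiable (at t within {0..})) \<and>
     continuous_on (UNIV \<times> {0..}) \<phi> \<and>
     (\<forall>b\<in>Basis. continuous_on (UNIV \<times> {0..}) (\<lambda>(x, t). partial b (\<lambda>y. \<phi> (y, t)) x)) \<and>
     (\<forall>b\<in>Basis. \<forall>c\<in>Basis.
        continuous_on (UNIV \<times> {0..}) (\<lambda>(x, t). partial c (partial b (\<lambda>y. \<phi> (y, t))) x)) \<and>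
     continuous_on (UNIV \<times> {0..}) (time_deriv \<phi>) \<and>
     compact (closure {(x, t). 0 \<le> t \<and> \<phi> (x, t) \<noteq> 0})"

definition Omega :: "('n::finite heisenberg \<times> real) set" where
  "Omega = UNIV \<times> {0<..}"

definition kirchhoff_coeff ::
  "(real \<Rightarrow> real \<Rightarrow> real \<Rightarrow> real) \<Rightarrow> ('n::finite heisenberg \<times> real \<Rightarrow> real) \<Rightarrow> real \<Rightarrow> real" where
  "kirchhoff_coeff M u t =
     M t (grad_energy (\<lambda>x. u (x, t))) (laplacian_energy (\<lambda>x. u (x, t)))"

text \<open>\<open>u\<close> is the representative whose time slices, for every \<open>t > 0\<close>, are the values of the
  \<open>C\<^sup>1\<close> map into \<open>S22\<close>. The equation is \<open>u_t - M(\<dots>) \<Delta>u = \<bar>u\<bar>\<^sup>p\<close>, \<open>u(\<cdot>,0) = u0 \<ge> 0\<close>.\<close>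

definition weak_solution ::
  "(real \<Rightarrow> real \<Rightarrow> real \<Rightarrow> real) \<Rightarrow> real \<Rightarrow> ('n::finite heisenberg \<Rightarrow> real) \<Rightarrow>
     ('n heisenberg \<times> real \<Rightarrow> real) \<Rightarrow> bool" where
  "weak_solution M p u0 u \<longleftrightarrow>
     integrable lebesgue u0 \<and> (AE x in lebesgue. 0 \<le> u0 x) \<and>
     C1_S22 (\<lambda>t x. u (x, t)) \<and> locally_Lp p Omega u \<and>
     (\<forall>\<phi>. test_function_21 \<phi> \<and> (\<forall>x. \<forall>t\<ge>0. 0 \<le> \<phi> (x, t)) \<longrightarrow>
        (let source = (\<lambda>z. \<bar>u z\<bar> powr p * \<phi> z);
             initial = (\<lambda>x. u0 x * \<phi> (x, 0));
             evolution = (\<lambda>z. u z * time_deriv \<phi> z);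
             diffusion = (\<lambda>(x, t). kirchhoff_coeff M u t * u (x, t) *
                                   kohn_laplacian (\<lambda>y. \<phi> (y, t)) x)
         in set_integrable lebesgue Omega source \<and>
            integrable lebesgue initial \<and>
            set_integrable lebesgue Omega evolution \<and>
            set_integrable lebesgue Omega diffusion \<and>
            (LINT z:Omega|lebesgue. source z) + (\<integral>x. initial x \<partial>lebesgue) =
              - (LINT z:Omega|lebesgue. evolution z) - (LINT z:Omega|lebesgue. diffusion z)))"

definition nontrivial :: "('n::finite heisenberg \<times> real \<Rightarrow> real) \<Rightarrow> bool" where
  "nontrivial u \<longleftrightarrow> \<not> (AE z in lebesgue. z \<in> Omega \<longrightarrow> u z = 0)"

end

theory Submission
  imports Defs
begin

text \<open>Test function method. The cutoff is \<open>\<phi> = w\<^sup>k\<close>, where \<open>w\<close> is the positive part of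
  \<open>1 - t / T - (\<bar>\<xi>\<bar>\<^sup>2 + \<bar>\<eta>\<bar>\<^sup>2) / r\<^sup>2 - \<tau>\<^sup>2 / r\<^sup>4\<close>; this is a polynomial, homogeneous under the
  Heisenberg dilations, so \<open>\<bar>\<phi>\<^sub>t\<bar> \<le> c w\<^sup>k\<^sup>-\<^sup>1 / T\<close> and \<open>\<bar>\<Delta>\<phi>\<bar> \<le> c w\<^sup>k\<^sup>-\<^sup>2 / r\<^sup>2\<close>. The scaling
  \<open>r\<^sup>2 = T powr (1 + \<beta>)\<close> balances \<open>T powr \<beta> / r\<^sup>2\<close> with \<open>1 / T\<close>, and for \<open>k\<close> with \<open>k / p \<le> k - 2\<close>
  Young's inequality absorbs \<open>\<bar>u\<bar> w\<^sup>k\<^sup>-\<^sup>2 / T\<close> into half of \<open>\<bar>u\<bar> powr p * \<phi>\<close>, at the price of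
  \<open>T powr (- p / (p - 1))\<close> times the volume \<open>r\<^sup>Q T\<close> of the support. Subcriticality makes this exponent
  of \<open>T\<close> negative. As \<open>\<phi>\<close> increases with \<open>T\<close> and is eventually positive at every point, \<open>u\<close> vanishes.\<close>

section \<open>Powers of the positive part\<close>

lemma DERIV_pos_part_power:
  "((\<lambda>s::real. max 0 s ^ Suc (Suc m)) has_real_derivative real (Suc (Suc m)) * max 0 s ^ Suc m) (at s)"
proof (cases s "0::real" rule: linorder_cases)
  case less
  have "((\<lambda>s::real. 0) has_real_derivative real (Suc (Suc m)) * max 0 s ^ Suc m) (at s)"
    using less by (simp add: max_def)
  then show ?thesis
    by (rule has_field_derivative_transform_within_open[where S="{..<0}"])
      (use less in \<open>auto simp: max_def\<close>)
next
  case equal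
  \<comment> \<open>Caratheodory's criterion at the corner: since
    \<open>max 0 z * z = max 0 z ^ 2\<close>, the difference quotient based at 0 is
    \<open>max 0 z ^ Suc m\<close>, which is continuous and vanishes there.\<close>
  have "\<exists>g. (\<forall>z. max 0 z ^ Suc (Suc m) - max 0 s ^ Suc (Suc m) = g z * (z - s)) \<and> isCont g s \<and>
     g s = real (Suc (Suc m)) * max 0 s ^ Suc m"
  proof (rule exI[where x="\<lambda>z. max 0 z ^ Suc m"], intro conjI allI)
    show "isCont (\<lambda>z. max 0 z ^ Suc m) s"
      by (intro continuous_intros)
  qed (use equal in \<open>auto simp: max_def\<close>)
  then show ?thesis
    by (simp add: CARAT_DERIV)
next
  case greater
  have "((\<lambda>s::real. s ^ Suc (Suc m)) has_real_derivative real (Suc (Suc m)) * max 0 s ^ Suc m) (at s)"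
    using greater DERIV_pow[of "Suc (Suc m)" s UNIV] by (simp add: max_def)
  then show ?thesis
    by (rule has_field_derivative_transform_within_open[where S="{0<..}"])
      (use greater in \<open>auto simp: max_def\<close>)
qed

lemma partial_eqI: "(f has_derivative f') (at x) \<Longrightarrow> partial b f x = f' b"
  unfolding partial_def by (metis frechet_derivative_at)

section \<open>The gauge, the cutoff and their derivatives\<close>

definition heis_gauge :: "real \<Rightarrow> 'n::finite heisenberg \<Rightarrow> real" where
  "heis_gauge r x = (fst x \<bullet> fst x + fst (snd x) \<bullet> fst (snd x)) / r^2 + (snd (snd x))^2 / r^4"

text \<open>Twice the polar form of the quadratic form \<open>heis_gauge r\<close>. It is symmetric
  and bilinear in \<open>b\<close> and \<open>x\<close>, so it serves both as the differential at
  \<open>x\<close> and, with directions in both slots, as the constant Hessian.\<close>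

definition heis_gauge_diff :: "real \<Rightarrow> 'n::finite heisenberg \<Rightarrow> 'n heisenberg \<Rightarrow> real" where
  "heis_gauge_diff r b x =
     2 * ((fst x \<bullet> fst b + fst (snd x) \<bullet> fst (snd b)) / r^2 + snd (snd x) * snd (snd b) / r^4)"

definition cutoff :: "nat \<Rightarrow> real \<Rightarrow> real \<Rightarrow> 'n::finite heisenberg \<times> real \<Rightarrow> real" where
  "cutoff k r T z = max 0 (1 - snd z / T - heis_gauge r (fst z)) ^ k"

lemma heis_gauge_has_derivative: "(heis_gauge r has_derivative (\<lambda>b. heis_gauge_diff r b x)) (at x)"
  unfolding heis_gauge_def[abs_def] heis_gauge_diff_def divide_inverse
  by (auto intro!: derivative_eq_intros simp: inner_commute algebra_simps fun_eq_iff)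

lemma heis_gauge_diff_has_derivative: "(heis_gauge_diff r b has_derivative (\<lambda>c. heis_gauge_diff r b c)) (at x)"
  unfolding heis_gauge_diff_def[abs_def] divide_inverse
  by (auto intro!: derivative_eq_intros simp: algebra_simps fun_eq_iff)

lemma pos_part_gauge_has_derivative:
  "((\<lambda>x. max 0 (c - heis_gauge r x) ^ Suc (Suc m)) has_derivative
     (\<lambda>b. - real (Suc (Suc m)) * max 0 (c - heis_gauge r x) ^ Suc m * heis_gauge_diff r b x)) (at x)"
proof -
  have "((\<lambda>x. c - heis_gauge r x) has_derivative (\<lambda>b. - heis_gauge_diff r b x)) (at x)"
    by (auto intro!: derivative_eq_intros heis_gauge_has_derivative)
  from has_derivative_compose[OF this DERIV_pos_part_power[of m, unfolded has_field_derivative_def]]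
  have "((\<lambda>x. max 0 (c - heis_gauge r x) ^ Suc (Suc m)) has_derivative
     (\<lambda>b. real (Suc (Suc m)) * max 0 (c - heis_gauge r x) ^ Suc m * - heis_gauge_diff r b x)) (at x)" .
  then show ?thesis by (simp only: mult_minus_left mult_minus_right)
qed

lemma partial_pos_part_gauge:
  "partial b (\<lambda>x. max 0 (c - heis_gauge r x) ^ Suc (Suc m)) =
     (\<lambda>x. - real (Suc (Suc m)) * max 0 (c - heis_gauge r x) ^ Suc m * heis_gauge_diff r b x)"
  by (rule ext) (rule partial_eqI[OF pos_part_gauge_has_derivative])

text \<open>First derivatives of a power of \<open>c - heis_gauge r x\<close>, along coordinates as
  well as along \<open>X_i\<close> and \<open>Y_i\<close>, are a power of the positive part times a
  polynomial \<open>l\<close>. This one product rule therefore serves the second partials and the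
  squares \<open>X_i\<^sup>2\<close>, \<open>Y_i\<^sup>2\<close>.\<close>

lemma pos_part_gauge_times_has_derivative:
  assumes "(l has_derivative l') (at x)"
  shows "((\<lambda>x. - real j * max 0 (c - heis_gauge r x) ^ Suc (Suc m) * l x) has_derivative
     (\<lambda>b. real j * (real (Suc (Suc m)) * max 0 (c - heis_gauge r x) ^ Suc m * heis_gauge_diff r b x * l x
        - max 0 (c - heis_gauge r x) ^ Suc (Suc m) * l' b))) (at x)"
proof -
  have "((\<lambda>x. - real j * max 0 (c - heis_gauge r x) ^ Suc (Suc m) * l x) has_derivative
     (\<lambda>b. - real j * max 0 (c - heis_gauge r x) ^ Suc (Suc m) * l' b + 
        - real j * (- real (Suc (Suc m)) * max 0 (c - heis_gauge r x) ^ Suc m * heis_gauge_diff r b x) * l x)) (at x)"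
    by (intro has_derivative_mult has_derivative_mult_right pos_part_gauge_has_derivative assms)
  then show ?thesis
    by (rule has_derivative_eq_rhs) (simp add: algebra_simps fun_eq_iff)
qed

lemma partial_partial_pos_part_gauge:
  "partial d (partial b (\<lambda>x. max 0 (c - heis_gauge r x) ^ Suc (Suc (Suc m)))) =
     (\<lambda>x. real (Suc (Suc (Suc m))) *
       (real (Suc (Suc m)) * max 0 (c - heis_gauge r x) ^ Suc m * heis_gauge_diff r d x * heis_gauge_diff r b x
        - max 0 (c - heis_gauge r x) ^ Suc (Suc m) * heis_gauge_diff r b d))"
  unfolding partial_pos_part_gauge
  by (rule ext) (rule partial_eqI[OF pos_part_gauge_times_has_derivative[OF heis_gauge_diff_has_derivative]])

lemma continuous_on_gauge [continuous_intros]: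
  "continuous_on S f \<Longrightarrow> continuous_on S (\<lambda>z. heis_gauge r (f z))"
  unfolding heis_gauge_def divide_inverse by (intro continuous_intros)

lemma continuous_on_gauge_diff [continuous_intros]:
  "continuous_on S f \<Longrightarrow> continuous_on S (\<lambda>z. heis_gauge_diff r b (f z))"
  unfolding heis_gauge_diff_def divide_inverse by (intro continuous_intros)

lemma time_deriv_cutoff:
  assumes "0 \<le> snd z"
  shows "time_deriv (cutoff (Suc (Suc m)) r T) z =
     - (real (Suc (Suc m)) / T) * max 0 (1 - snd z / T - heis_gauge r (fst z)) ^ Suc m"
    and "(\<lambda>s. cutoff (Suc (Suc m)) r T (fst z, s)) differentiable (at (snd z) within {0..})"
proof -
  obtain x t where z: "z = (x, t)" by fastforce
  have "((\<lambda>s. 1 - s / T - heis_gauge r x) has_real_derivative - 1 / T) (at t)"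
    unfolding divide_inverse by (auto intro!: derivative_eq_intros)
  from DERIV_chain2[OF DERIV_pos_part_power[of m] this]
  have d: "((\<lambda>s. cutoff (Suc (Suc m)) r T (x, s)) has_vector_derivative
     - (real (Suc (Suc m)) / T) * max 0 (1 - t / T - heis_gauge r x) ^ Suc m) (at t within {0..})"
    unfolding cutoff_def
    by (auto simp: has_real_derivative_iff_has_vector_derivative intro: has_vector_derivative_at_within)
  \<comment> \<open>A derivative within \<open>{0..}\<close> is unique only at a limit point; points
    to the right of \<open>t\<close> suffice, also when \<open>t = 0\<close>.\<close>
  have "at t within {0..} \<noteq> bot"
  proof -
    have "{t<..} \<subseteq> {0..}" using assms z by auto
    then have "at_right t \<le> at t within {0..}" by (rule at_le)
    then show ?thesis by (auto simp: bot_unique)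
  qed
  then show "time_deriv (cutoff (Suc (Suc m)) r T) z =
     - (real (Suc (Suc m)) / T) * max 0 (1 - snd z / T - heis_gauge r (fst z)) ^ Suc m"
    using vector_derivative_within[OF _ d] by (simp add: z time_deriv_def)
  show "(\<lambda>s. cutoff (Suc (Suc m)) r T (fst z, s)) differentiable (at (snd z) within {0..})"
    using d unfolding z by (auto intro: differentiableI_vector)
qed

section \<open>Support of the cutoff and its admissibility as a test function\<close>

definition support_box :: "real \<Rightarrow> real \<Rightarrow> ('n::finite heisenberg \<times> real) set" where
  "support_box r T = cbox ((\<chi> i. - r, \<chi> i. - r, - (r^2)), 0) ((\<chi> i. r, \<chi> i. r, r^2), T)"

lemma heis_gauge_nonneg: "0 \<le> heis_gauge r x"
  unfolding heis_gauge_def by auto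

lemma heis_gauge_le_1D:
  assumes "0 < r" "heis_gauge r x \<le> 1"
  shows "\<bar>fst x $ i\<bar> \<le> r" "\<bar>fst (snd x) $ i\<bar> \<le> r" "\<bar>snd (snd x)\<bar> \<le> r^2"
proof -
  have a: "(fst x $ i)^2 \<le> fst x \<bullet> fst x" "(fst (snd x) $ i)^2 \<le> fst (snd x) \<bullet> fst (snd x)" for i
    by (metis component_le_norm_cart dot_square_norm norm_ge_zero power2_abs power_mono abs_ge_zero)+
  have s: "(fst x \<bullet> fst x) / r^2 + (fst (snd x) \<bullet> fst (snd x)) / r^2 + (snd (snd x))^2 / r^4 \<le> 1"
    using assms by (simp add: heis_gauge_def add_divide_distrib)
  have q: "0 \<le> (fst x \<bullet> fst x) / r^2" "0 \<le> (fst (snd x) \<bullet> fst (snd x)) / r^2" "0 \<le> (snd (snd x))^2 / r^4"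
    by auto
  have "(fst x \<bullet> fst x) / r^2 \<le> 1" "(fst (snd x) \<bullet> fst (snd x)) / r^2 \<le> 1" "(snd (snd x))^2 / r^4 \<le> 1"
    using s q by linarith+
  then have "fst x \<bullet> fst x \<le> r^2" "fst (snd x) \<bullet> fst (snd x) \<le> r^2" "(snd (snd x))^2 \<le> (r^2)^2"
    using assms(1) by (simp_all add: divide_le_eq)
  then show "\<bar>fst x $ i\<bar> \<le> r" "\<bar>fst (snd x) $ i\<bar> \<le> r" "\<bar>snd (snd x)\<bar> \<le> r^2"
    using order_trans[OF a(1)[of i]] order_trans[OF a(2)[of i]] assms(1)
    by (simp_all flip: power2_le_iff_abs_le)
qed

lemma support_boxI:
  assumes "0 < r" "0 \<le> snd z" "0 < T" "0 < 1 - snd z / T - heis_gauge r (fst z)"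
  shows "z \<in> support_box r T"
proof -
  have "0 \<le> snd z / T" using assms by simp
  then have g: "heis_gauge r (fst z) \<le> 1" and t: "snd z / T \<le> 1"
    using assms(4) heis_gauge_nonneg[of r "fst z"] by linarith+
  then have "snd z \<le> T" using assms by (simp add: divide_le_eq)
  then show ?thesis
    using heis_gauge_le_1D[OF assms(1) g] assms(2)
    by (cases z) (auto simp: support_box_def cbox_Pair_eq mem_box_cart abs_le_iff minus_le_iff)
qed

text \<open>The \<open>2 * CARD('n)\<close> horizontal sides have length \<open>2 * r\<close>, the
  vertical one \<open>2 * r^2\<close>. The exponent of \<open>r\<close> is thus the homogeneous
  dimension Q, one more than the topological dimension, which counts the factors 2.\<close>

lemma measure_support_box:
  assumes "0 < r" "0 < T"
  shows "measure lebesgue (support_box r T :: ('n::finite heisenberg \<times> real) set) =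
    2 ^ (2 * CARD('n) + 1) * r ^ (2 * CARD('n) + 2) * T"
proof -
  have c: "measure lborel (cbox (\<chi> i. - r) (\<chi> i. r) :: (real^'n) set) = (2 * r) ^ CARD('n)"
    using assms by (subst content_cbox_cart) (auto simp: interval_eq_empty_cart not_less)
  have "(2 * r) ^ CARD('n) * ((2 * r) ^ CARD('n) * (2 * r\<^sup>2)) * T =
     2 ^ (2 * CARD('n) + 1) * r ^ (2 * CARD('n) + 2) * T"
    by (simp add: power_mult_distrib power_add power_mult power2_eq_square algebra_simps)
  moreover have "measure lebesgue (support_box r T :: ('n heisenberg \<times> real) set) =
     measure lborel (support_box r T :: ('n heisenberg \<times> real) set)"
    by (simp add: support_box_def)
  ultimately show ?thesis
    using assms by (simp only: support_box_def content_Pair c) simp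
qed

text \<open>Two derivatives lower the exponent \<open>m + 3\<close> to \<open>m + 1\<close>. As this
  is still positive, the second partials remain continuous across the boundary of the
  support.\<close>

lemma C_times_2_cutoff:
  "C_times 2 (\<lambda>x :: 'n::finite heisenberg. cutoff (Suc (Suc (Suc m))) r T (x, t))"
proof -
  let ?F = "\<lambda>x :: 'n heisenberg. max 0 ((1 - t / T) - heis_gauge r x) ^ Suc (Suc (Suc m))"
  have "?F differentiable (at x)" for x
    by (rule differentiableI[OF pos_part_gauge_has_derivative])
  moreover have "partial b ?F differentiable (at x)" for b x
    unfolding partial_pos_part_gauge
    by (rule differentiableI[OF pos_part_gauge_times_has_derivative[OF heis_gauge_diff_has_derivative]])
  moreover have "continuous_on UNIV (partial d (partial b ?F))" for b d
    unfolding partial_partial_pos_part_gauge by (intro continuous_intros)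
  ultimately show ?thesis
    by (simp add: numeral_2_eq_2 cutoff_def del: power_Suc)
qed

lemma test_function_21_cutoff:
  assumes "0 < r" "0 < T"
  shows "test_function_21 (cutoff (Suc (Suc (Suc m))) r T :: 'n::finite heisenberg \<times> real \<Rightarrow> real)"
proof -
  let ?k = "Suc (Suc (Suc m))"
  let ?D = "UNIV \<times> {0..} :: ('n heisenberg \<times> real) set"
  let ?\<phi> = "cutoff ?k r T :: 'n heisenberg \<times> real \<Rightarrow> real"
  have T: "T \<noteq> 0" using assms by simp
  \<comment> \<open>At fixed time the cutoff is a gauge power with \<open>c = 1 - t / T\<close>, so
    the spatial formulas above apply to each slice.\<close>
  have sl: "(\<lambda>x :: 'n heisenberg. ?\<phi> (x, t)) = (\<lambda>x. max 0 ((1 - t / T) - heis_gauge r x) ^ ?k)" for t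
    by (simp add: cutoff_def)
  have cw: "continuous_on ?D (\<lambda>z. max 0 (1 - snd z / T - heis_gauge r (fst z)) ^ j)" for j
    using T by (intro continuous_intros) auto
  have "continuous_on ?D ?\<phi>"
    using cw[of ?k] by (simp add: cutoff_def[abs_def])
  moreover have "continuous_on ?D (\<lambda>(x, t). partial b (\<lambda>y. ?\<phi> (y, t)) x)" for b
    unfolding sl partial_pos_part_gauge case_prod_unfold by (intro continuous_intros cw)
  moreover have "continuous_on ?D (\<lambda>(x, t). partial d (partial b (\<lambda>y. ?\<phi> (y, t))) x)" for b d
    unfolding sl partial_partial_pos_part_gauge case_prod_unfold by (intro continuous_intros cw)
  moreover have "continuous_on ?D (time_deriv ?\<phi>)"
  proof (rule continuous_on_eq)
    show "continuous_on ?D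
      (\<lambda>z. - (real ?k / T) * max 0 (1 - snd z / T - heis_gauge r (fst z)) ^ Suc (Suc m))"
      by (intro continuous_intros cw)
  qed (auto simp: time_deriv_cutoff simp del: power_Suc of_nat_Suc)
  moreover have "compact (closure {(x, t). 0 \<le> t \<and> ?\<phi> (x, t) \<noteq> 0})"
  proof -
    have "{(x, t). 0 \<le> t \<and> ?\<phi> (x, t) \<noteq> 0} \<subseteq> support_box r T"
    proof safe
      fix x :: "'n heisenberg" and t assume "0 \<le> t" "?\<phi> (x, t) \<noteq> 0"
      then show "(x, t) \<in> support_box r T"
        by (intro support_boxI assms) (auto simp: cutoff_def max_def split: if_splits)
    qed
    then show ?thesis
      unfolding compact_closure by (rule bounded_subset[rotated]) (simp add: support_box_def)
  qed
  moreover have "(\<lambda>s. ?\<phi> (x, s)) differentiable (at t within {0..})" if "0 \<le> t" for x t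
    using time_deriv_cutoff(2)[of "(x, t)"] that by simp
  ultimately show ?thesis
    unfolding test_function_21_def
    by (intro conjI allI ballI impI C_times_2_cutoff)
qed

section \<open>Horizontal fields and the Kohn-Laplacian on the cutoff\<close>

definition X_gauge :: "real \<Rightarrow> 'n \<Rightarrow> 'n::finite heisenberg \<Rightarrow> real" where
  "X_gauge r i x = 2 * (fst x $ i / r^2 + 2 * (fst (snd x) $ i * snd (snd x)) / r^4)"

text \<open>Together with \<open>X_gauge\<close>, the closed forms of \<open>Y_i\<close> and
  \<open>X_i\<close> applied to \<open>heis_gauge r\<close>.\<close>

definition Y_gauge :: "real \<Rightarrow> 'n \<Rightarrow> 'n::finite heisenberg \<Rightarrow> real" where
  "Y_gauge r i x = 2 * (fst (snd x) $ i / r^2 - 2 * (fst x $ i * snd (snd x)) / r^4)"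

lemma coordinate_has_derivative:
  "((\<lambda>x :: 'n::finite heisenberg. fst x $ i) has_derivative (\<lambda>b. fst b $ i)) F"
  "((\<lambda>x :: 'n::finite heisenberg. fst (snd x) $ i) has_derivative (\<lambda>b. fst (snd b) $ i)) F"
  "((\<lambda>x :: 'n::finite heisenberg. snd (snd x)) has_derivative (\<lambda>b. snd (snd b))) F"
  by (intro bounded_linear.has_derivative[OF bounded_linear_vec_nth] has_derivative_fst
      has_derivative_snd has_derivative_ident)+

lemma X_gauge_has_derivative:
  "(X_gauge r i has_derivative (\<lambda>b. 2 * (fst b $ i / r^2 +
     2 * (fst (snd x) $ i * snd (snd b) + fst (snd b) $ i * snd (snd x)) / r^4))) (at x)"
  unfolding X_gauge_def[abs_def] divide_inverse
  by (intro has_derivative_mult_right has_derivative_mult_left has_derivative_add has_derivative_mult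
      coordinate_has_derivative)

lemma Y_gauge_has_derivative:
  "(Y_gauge r i has_derivative (\<lambda>b. 2 * (fst (snd b) $ i / r^2 -
     2 * (fst x $ i * snd (snd b) + fst b $ i * snd (snd x)) / r^4))) (at x)"
  unfolding Y_gauge_def[abs_def] divide_inverse
  by (intro has_derivative_mult_right has_derivative_mult_left has_derivative_diff has_derivative_mult
      coordinate_has_derivative)

lemma X_field_pos_part_gauge:
  "X_field i (\<lambda>x. max 0 (c - heis_gauge r x) ^ Suc (Suc m)) =
     (\<lambda>x. - real (Suc (Suc m)) * max 0 (c - heis_gauge r x) ^ Suc m * X_gauge r i x)"
  unfolding X_field_def partial_pos_part_gauge
  by (auto simp: fun_eq_iff heis_gauge_diff_def X_gauge_def inner_axis algebra_simps simp del: power_Suc of_nat_Suc)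

lemma Y_field_pos_part_gauge:
  "Y_field i (\<lambda>x. max 0 (c - heis_gauge r x) ^ Suc (Suc m)) =
     (\<lambda>x. - real (Suc (Suc m)) * max 0 (c - heis_gauge r x) ^ Suc m * Y_gauge r i x)"
  unfolding Y_field_def partial_pos_part_gauge
  by (auto simp: fun_eq_iff heis_gauge_diff_def Y_gauge_def inner_axis algebra_simps simp del: power_Suc of_nat_Suc)

text \<open>For passing from partial derivatives to a field: the coefficient \<open>s\<close>, which
  is \<open>2 * \<eta> $ i\<close> or \<open>2 * \<xi> $ i\<close>, moves inside the bracket, where
  \<open>g1 \<plusminus> s * g2\<close> and \<open>l1 \<plusminus> s * l2\<close> become the field
  applied to the gauge and to its first field derivative.\<close>

lemma field_bracket_identity:
  fixes k h W V Z s g1 g2 l1 l2 :: real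
  shows "k * (h * W * g1 * Z - V * l1) + s * (k * (h * W * g2 * Z - V * l2)) =
      k * (h * W * ((g1 + s * g2) * Z) - V * (l1 + s * l2))"
    and "k * (h * W * g1 * Z - V * l1) - s * (k * (h * W * g2 * Z - V * l2)) =
      k * (h * W * ((g1 - s * g2) * Z) - V * (l1 - s * l2))"
  by (simp_all add: algebra_simps)

text \<open>Chain rule for a power of \<open>c - g\<close>, with g the gauge: the square term comes
  from the outer second derivative, and the last bracket is \<open>X_i\<^sup>2 g\<close>.\<close>

lemma X_field_X_field_pos_part_gauge:
  "X_field i (X_field i (\<lambda>x. max 0 (c - heis_gauge r x) ^ Suc (Suc (Suc m)))) x =
     real (Suc (Suc (Suc m))) *
       (real (Suc (Suc m)) * max 0 (c - heis_gauge r x) ^ Suc m * (X_gauge r i x)^2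
        - max 0 (c - heis_gauge r x) ^ Suc (Suc m) * (2 / r^2 + 8 * (fst (snd x) $ i)^2 / r^4))"
proof -
  obtain \<xi> \<eta> \<tau> where x: "x = (\<xi>, \<eta>, \<tau>)" by (metis surj_pair)
  let ?w = "max 0 (c - heis_gauge r x)"
  let ?k = "real (Suc (Suc (Suc m)))"
  let ?l = "\<lambda>b. 2 * (fst b $ i / r^2 +
     2 * (fst (snd x) $ i * snd (snd b) + fst (snd b) $ i * snd (snd x)) / r^4)"
  have "partial b (X_field i (\<lambda>x. max 0 (c - heis_gauge r x) ^ Suc (Suc (Suc m)))) x =
    ?k * (real (Suc (Suc m)) * ?w ^ Suc m * heis_gauge_diff r b x * X_gauge r i x
      - ?w ^ Suc (Suc m) * ?l b)" for b
    unfolding X_field_pos_part_gauge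
    by (rule partial_eqI[OF pos_part_gauge_times_has_derivative[OF X_gauge_has_derivative]])
  then have "X_field i (X_field i (\<lambda>x. max 0 (c - heis_gauge r x) ^ Suc (Suc (Suc m)))) x =
    ?k * (real (Suc (Suc m)) * ?w ^ Suc m * heis_gauge_diff r (axis i 1, 0, 0) x * X_gauge r i x
      - ?w ^ Suc (Suc m) * ?l (axis i 1, 0, 0)) + 2 * \<eta> $ i *
    (?k * (real (Suc (Suc m)) * ?w ^ Suc m * heis_gauge_diff r (0, 0, 1) x * X_gauge r i x
      - ?w ^ Suc (Suc m) * ?l (0, 0, 1)))"
    unfolding X_field_def[of i "X_field i _"] x prod.case by simp
  also have "\<dots> = ?k * (real (Suc (Suc m)) * ?w ^ Suc m *
      ((heis_gauge_diff r (axis i 1, 0, 0) x + 2 * \<eta> $ i * heis_gauge_diff r (0, 0, 1) x) * X_gauge r i x)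
      - ?w ^ Suc (Suc m) * (?l (axis i 1, 0, 0) + 2 * \<eta> $ i * ?l (0, 0, 1)))"
    by (rule field_bracket_identity)
  also have "heis_gauge_diff r (axis i 1, 0, 0) x + 2 * \<eta> $ i * heis_gauge_diff r (0, 0, 1) x = X_gauge r i x"
    by (simp add: x heis_gauge_diff_def X_gauge_def inner_axis algebra_simps)
  also have "?l (axis i 1, 0, 0) + 2 * \<eta> $ i * ?l (0, 0, 1) = 2 / r^2 + 8 * (fst (snd x) $ i)^2 / r^4"
    by (simp add: x power2_eq_square)
  finally show ?thesis
    by (simp only: power2_eq_square)
qed

lemma Y_field_Y_field_pos_part_gauge:
  "Y_field i (Y_field i (\<lambda>x. max 0 (c - heis_gauge r x) ^ Suc (Suc (Suc m)))) x =
     real (Suc (Suc (Suc m))) *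
       (real (Suc (Suc m)) * max 0 (c - heis_gauge r x) ^ Suc m * (Y_gauge r i x)^2
        - max 0 (c - heis_gauge r x) ^ Suc (Suc m) * (2 / r^2 + 8 * (fst x $ i)^2 / r^4))"
proof -
  obtain \<xi> \<eta> \<tau> where x: "x = (\<xi>, \<eta>, \<tau>)" by (metis surj_pair)
  let ?w = "max 0 (c - heis_gauge r x)"
  let ?k = "real (Suc (Suc (Suc m)))"
  let ?l = "\<lambda>b. 2 * (fst (snd b) $ i / r^2 -
     2 * (fst x $ i * snd (snd b) + fst b $ i * snd (snd x)) / r^4)"
  have "partial b (Y_field i (\<lambda>x. max 0 (c - heis_gauge r x) ^ Suc (Suc (Suc m)))) x =
    ?k * (real (Suc (Suc m)) * ?w ^ Suc m * heis_gauge_diff r b x * Y_gauge r i x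
      - ?w ^ Suc (Suc m) * ?l b)" for b
    unfolding Y_field_pos_part_gauge
    by (rule partial_eqI[OF pos_part_gauge_times_has_derivative[OF Y_gauge_has_derivative]])
  then have "Y_field i (Y_field i (\<lambda>x. max 0 (c - heis_gauge r x) ^ Suc (Suc (Suc m)))) x =
    ?k * (real (Suc (Suc m)) * ?w ^ Suc m * heis_gauge_diff r (0, axis i 1, 0) x * Y_gauge r i x
      - ?w ^ Suc (Suc m) * ?l (0, axis i 1, 0)) - 2 * \<xi> $ i *
    (?k * (real (Suc (Suc m)) * ?w ^ Suc m * heis_gauge_diff r (0, 0, 1) x * Y_gauge r i x
      - ?w ^ Suc (Suc m) * ?l (0, 0, 1)))"
    unfolding Y_field_def[of i "Y_field i _"] x prod.case by simp
  also have "\<dots> = ?k * (real (Suc (Suc m)) * ?w ^ Suc m *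
      ((heis_gauge_diff r (0, axis i 1, 0) x - 2 * \<xi> $ i * heis_gauge_diff r (0, 0, 1) x) * Y_gauge r i x)
      - ?w ^ Suc (Suc m) * (?l (0, axis i 1, 0) - 2 * \<xi> $ i * ?l (0, 0, 1)))"
    by (rule field_bracket_identity)
  also have "heis_gauge_diff r (0, axis i 1, 0) x - 2 * \<xi> $ i * heis_gauge_diff r (0, 0, 1) x = Y_gauge r i x"
    by (simp add: x heis_gauge_diff_def Y_gauge_def inner_axis algebra_simps)
  also have "?l (0, axis i 1, 0) - 2 * \<xi> $ i * ?l (0, 0, 1) = 2 / r^2 + 8 * (fst x $ i)^2 / r^4"
    by (simp add: x power2_eq_square)
  finally show ?thesis
    by (simp only: power2_eq_square)
qed

lemma abs_diff_le_add:
  fixes x y :: real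
  shows "0 \<le> x \<Longrightarrow> x \<le> X \<Longrightarrow> 0 \<le> y \<Longrightarrow> y \<le> Y \<Longrightarrow> \<bar>x - y\<bar> \<le> X + Y"
  by linarith

text \<open>Common scalar form for both fields: \<open>(a, b, c)\<close> is (\<xi>_i, \<eta>_i,
  \<tau>) for X and (\<eta>_i, \<xi>_i, -\<tau>) for Y, \<open>D\<close> is the field applied to the
  gauge, \<open>h = k - 1\<close>, and \<open>W\<close>, \<open>V\<close> are the powers
  \<open>k - 2\<close>, \<open>k - 1\<close> of the positive part. From
  \<open>\<bar>D\<bar> \<le> 6 / r\<close> comes 36, from the second derivative
  \<open>2 + 8 = 10\<close>, in total 46.\<close>

lemma second_order_term_bound:
  fixes h k r a b c D V W :: real
  assumes "0 < r" "0 \<le> V" "V \<le> W" "0 \<le> h" "h \<le> k" "1 \<le> k"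
    and "\<bar>a\<bar> \<le> r" "\<bar>b\<bar> \<le> r" "\<bar>c\<bar> \<le> r^2"
    and D: "\<bar>D\<bar> = 2 * \<bar>a / r^2 + 2 * (b * c) / r^4\<bar>"
  shows "\<bar>k * (h * W * D^2 - V * (2 / r^2 + 8 * b^2 / r^4))\<bar> \<le> 46 * k^2 / r^2 * W"
proof -
  have "\<bar>a / r^2\<bar> \<le> r / r^2" using assms by (simp add: divide_right_mono)
  also have "r / r^2 = 1 / r" by (simp add: power2_eq_square)
  finally have 1: "\<bar>a / r^2\<bar> \<le> 1 / r" .
  have "\<bar>2 * (b * c) / r^4\<bar> \<le> 2 * (r * r^2) / r^4"
    using assms by (simp add: abs_mult divide_right_mono mult_mono)
  also have "\<dots> = 2 / r" using \<open>0 < r\<close> by (simp add: power2_eq_square power4_eq_xxxx)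
  finally have 2: "\<bar>2 * (b * c) / r^4\<bar> \<le> 2 / r" .
  have "\<bar>D\<bar> \<le> 2 * (1 / r + 2 / r)"
    unfolding D by (intro mult_left_mono order_trans[OF abs_triangle_ineq] add_mono 1 2) simp
  also have "\<dots> = 6 / r" by simp
  finally have "\<bar>D\<bar> \<le> 6 / r" .
  then have "\<bar>D\<bar>^2 \<le> (6 / r)^2" by (intro power_mono) auto
  then have D2: "D^2 \<le> 36 / r^2" by (simp add: power_divide)
  have "b^2 \<le> r^2" using \<open>\<bar>b\<bar> \<le> r\<close> \<open>0 < r\<close> abs_le_square_iff[of b r] by simp
  then have "b^2 / r^4 \<le> r^2 / r^4" by (rule divide_right_mono) simp
  also have "\<dots> = 1 / r^2" using \<open>0 < r\<close> by (simp add: divide_simps flip: power_add)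
  finally have "b^2 / r^4 \<le> 1 / r^2" .
  then have "2 / r^2 + 8 * (b^2 / r^4) \<le> 2 / r^2 + 8 * (1 / r^2)"
    by (intro add_left_mono mult_left_mono) simp_all
  also have "\<dots> = 10 / r^2" by simp
  finally have e: "2 / r^2 + 8 * b^2 / r^4 \<le> 10 / r^2" "0 \<le> 2 / r^2 + 8 * b^2 / r^4"
    by (simp_all only: times_divide_eq_right) simp
  have W: "0 \<le> W" using assms(2,3) by simp
  have "h * W * D^2 \<le> k * W * (36 / r^2)" "0 \<le> h * W * D^2"
    using assms(4-6) D2 W by (intro mult_mono mult_nonneg_nonneg; simp)+
  moreover have "V \<le> k * W" using mult_mono[of 1 k V W] assms(2,3,6) W by simp
  then have "V * (2 / r^2 + 8 * b^2 / r^4) \<le> k * W * (10 / r^2)"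
    using e assms(6) W by (intro mult_mono) simp_all
  moreover have "0 \<le> V * (2 / r^2 + 8 * b^2 / r^4)"
    using e(2) assms(2) by (intro mult_nonneg_nonneg)
  moreover have "0 \<le> k * W * (36 / r^2)" "0 \<le> k * W * (10 / r^2)" using assms(6) W by auto
  ultimately have "\<bar>h * W * D^2 - V * (2 / r^2 + 8 * b^2 / r^4)\<bar> \<le> k * W * (36 / r^2) + k * W * (10 / r^2)"
    by (intro abs_diff_le_add)
  then have "k * \<bar>h * W * D^2 - V * (2 / r^2 + 8 * b^2 / r^4)\<bar> \<le> k * (k * W * (36 / r^2) + k * W * (10 / r^2))"
    using assms(6) by (intro mult_left_mono) auto
  also have "\<dots> = 46 * k^2 / r^2 * W"
    by (simp add: power2_eq_square)
  finally show ?thesis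
    using \<open>1 \<le> k\<close> by (subst abs_mult) simp
qed

text \<open>There are \<open>2 * CARD('n)\<close> squares of fields, each contributing the constant
  46.\<close>

lemma kohn_laplacian_cutoff_bound:
  fixes x :: "'n::finite heisenberg"
  assumes "0 < r" "0 < T" "0 \<le> t"
  shows "\<bar>kohn_laplacian (\<lambda>y. cutoff (Suc (Suc (Suc m))) r T (y, t)) x\<bar>
    \<le> 92 * real CARD('n) * real (Suc (Suc (Suc m)))^2 / r^2 * max 0 (1 - t / T - heis_gauge r x) ^ Suc m"
proof -
  let ?k = "Suc (Suc (Suc m))"
  let ?F = "\<lambda>x :: 'n heisenberg. max 0 ((1 - t / T) - heis_gauge r x) ^ ?k"
  let ?w = "max 0 (1 - t / T - heis_gauge r x)"
  let ?B = "46 * real ?k ^ 2 / r^2 * ?w ^ Suc m"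
  have w1: "?w \<le> 1" using assms heis_gauge_nonneg[of r x] by (simp add: diff_le_eq add_nonneg_nonneg)
  have "\<bar>X_field i (X_field i ?F) x\<bar> \<le> ?B \<and> \<bar>Y_field i (Y_field i ?F) x\<bar> \<le> ?B" for i
  \<comment> \<open>The coordinates are controlled only where the gauge is at most 1; elsewhere
    \<open>?w\<close> vanishes, and its positive powers annihilate both terms.\<close>
  proof (cases "?w = 0")
    case True
    then show ?thesis
      unfolding X_field_X_field_pos_part_gauge Y_field_Y_field_pos_part_gauge by simp
  next
    case False
    have "0 \<le> t / T" using assms by simp
    with False have g: "heis_gauge r x \<le> 1" by (auto simp: max_def split: if_splits)
    note b = heis_gauge_le_1D(1,2)[OF assms(1) g, of i] heis_gauge_le_1D(3)[OF assms(1) g]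
    have W: "0 \<le> ?w ^ Suc (Suc m)" "?w ^ Suc (Suc m) \<le> ?w ^ Suc m"
      using w1 by (auto intro!: power_decreasing simp del: power_Suc)
    have X: "\<bar>X_gauge r i x\<bar> = 2 * \<bar>fst x $ i / r^2 + 2 * (fst (snd x) $ i * snd (snd x)) / r^4\<bar>"
      by (simp only: X_gauge_def abs_mult abs_numeral)
    have Y: "\<bar>Y_gauge r i x\<bar> = 2 * \<bar>fst (snd x) $ i / r^2 + 2 * (fst x $ i * - snd (snd x)) / r^4\<bar>"
      by (simp only: Y_gauge_def abs_mult abs_numeral mult_minus_right divide_minus_left
          add_uminus_conv_diff)
    show ?thesis
      unfolding X_field_X_field_pos_part_gauge Y_field_Y_field_pos_part_gauge
    proof (intro conjI)
      show "\<bar>real ?k * (real (Suc (Suc m)) * ?w ^ Suc m * (X_gauge r i x)\<^sup>2 -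
          ?w ^ Suc (Suc m) * (2 / r\<^sup>2 + 8 * (fst (snd x) $ i)\<^sup>2 / r ^ 4))\<bar> \<le> ?B"
        by (rule second_order_term_bound[OF assms(1) W _ _ _ b X]) simp_all
      show "\<bar>real ?k * (real (Suc (Suc m)) * ?w ^ Suc m * (Y_gauge r i x)\<^sup>2 -
          ?w ^ Suc (Suc m) * (2 / r\<^sup>2 + 8 * (fst x $ i)\<^sup>2 / r ^ 4))\<bar> \<le> ?B"
        by (rule second_order_term_bound[OF assms(1) W _ _ _ b(2,1) _ Y]) (simp_all add: b(3))
    qed
  qed
  then have "\<bar>X_field i (X_field i ?F) x + Y_field i (Y_field i ?F) x\<bar> \<le> ?B + ?B" for i
    by (intro order_trans[OF abs_triangle_ineq] add_mono) blast+
  then have "(\<Sum>i\<in>UNIV. \<bar>X_field i (X_field i ?F) x + Y_field i (Y_field i ?F) x\<bar>) \<le> (\<Sum>i\<in>(UNIV :: 'n set). ?B + ?B)"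
    by (intro sum_mono)
  also have "\<dots> = 92 * real CARD('n) * real ?k ^ 2 / r^2 * ?w ^ Suc m"
    by (simp del: power_Suc of_nat_Suc)
  finally show ?thesis
    unfolding kohn_laplacian_def cutoff_def fst_conv snd_conv
    by (rule order_trans[OF sum_abs])
qed

section \<open>Young's inequality with weights\<close>

lemma mult_le_half_powr_plus:
  fixes A y p :: real
  assumes "1 < p" "0 \<le> A" "0 \<le> y"
  shows "A * y \<le> y powr p / 2 + (2 * A) powr (p / (p - 1))"
\<comment> \<open>Either \<open>A\<close> is so small that half of \<open>y powr p\<close> dominates
  the product, or \<open>y\<close> is bounded by a power of \<open>2 * A\<close> and the constant
  term dominates.\<close>
proof (cases "2 * A \<le> y powr (p - 1)")
  case True
  then have "y * (2 * A) \<le> y * y powr (p - 1)" using assms by (intro mult_left_mono)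
  also have "\<dots> = y powr p" using assms by (simp add: powr_mult_base)
  finally have "A * y \<le> y powr p / 2" by (simp add: mult.commute mult.left_commute)
  then show ?thesis by (smt (verit) powr_ge_zero)
next
  case False
  have "y = (y powr (p - 1)) powr (1 / (p - 1))"
    using assms by (simp add: powr_powr)
  also have "\<dots> \<le> (2 * A) powr (1 / (p - 1))"
    using False assms by (intro powr_mono2) auto
  finally have "A * y \<le> (2 * A) * (2 * A) powr (1 / (p - 1))"
    using assms by (intro mult_mono) auto
  also have "\<dots> = (2 * A) powr (1 + 1 / (p - 1))" using assms by (simp add: powr_mult_base)
  also have "1 + 1 / (p - 1) = p / (p - 1)" using assms by (simp add: field_simps)
  finally show ?thesis by (smt (verit) powr_ge_zero divide_nonneg_nonneg)
qed

text \<open>Apply the unweighted inequality to \<open>y = \<bar>v\<bar> * w powr (k / p)\<close>,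
  whose \<open>p\<close>-th power is \<open>\<bar>v\<bar> powr p * w ^ k\<close>. Since
  \<open>w \<le> 1\<close> and \<open>k / p \<le> j\<close>, the factor \<open>w ^ j\<close> is no
  larger than the weight in \<open>y\<close>.\<close>

lemma weighted_young:
  fixes A v w p :: real
  assumes "1 < p" "0 \<le> A" "0 \<le> w" "w \<le> 1" "real k / p \<le> real j" "0 < k"
  shows "A * \<bar>v\<bar> * w ^ j \<le> \<bar>v\<bar> powr p * w ^ k / 2 + (2 * A) powr (p / (p - 1))"
proof -
  have "0 < real k / p" using assms by simp
  \<comment> \<open>Positivity matters at \<open>w = 0\<close>, where \<open>w powr (k / p)\<close>
    is 0 but \<open>w ^ 0\<close> would be 1.\<close>
  then have j: "0 < j" using assms(5) by (cases j) auto
  have "w ^ j \<le> w powr (real k / p)"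
  proof (cases "w = 0")
    case False
    then have "w ^ j = w powr real j" using assms by (simp add: powr_realpow)
    also have "\<dots> \<le> w powr (real k / p)" using False assms by (intro powr_mono') auto
    finally show ?thesis .
  qed (use j in \<open>simp add: zero_power\<close>)
  then have "A * \<bar>v\<bar> * w ^ j \<le> A * (\<bar>v\<bar> * w powr (real k / p))"
    using assms by (simp add: mult_left_mono mult.assoc)
  also have "\<dots> \<le> (\<bar>v\<bar> * w powr (real k / p)) powr p / 2 + (2 * A) powr (p / (p - 1))"
    using assms by (intro mult_le_half_powr_plus) auto
  also have "(\<bar>v\<bar> * w powr (real k / p)) powr p = \<bar>v\<bar> powr p * w ^ k"
    using assms by (cases "w = 0") (auto simp: powr_mult powr_powr powr_realpow)
  finally show ?thesis .
qed

section \<open>The integral estimate for a fixed cutoff\<close>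

lemma kirchhoff_coeff_bounds:
  assumes "\<And>t a b. 0 < t \<Longrightarrow> 0 \<le> a \<Longrightarrow> 0 \<le> b \<Longrightarrow> 0 < M t a b \<and> M t a b \<le> C * t powr \<beta>"
    and "0 < t"
  shows "0 < kirchhoff_coeff M u t" "kirchhoff_coeff M u t \<le> C * t powr \<beta>"
proof -
  have "0 \<le> grad_energy (\<lambda>x. u (x, t))" "0 \<le> laplacian_energy (\<lambda>x. u (x, t))"
    by (simp_all add: grad_energy_def laplacian_energy_def)
  then show "0 < kirchhoff_coeff M u t" "kirchhoff_coeff M u t \<le> C * t powr \<beta>"
    using assms by (auto simp: kirchhoff_coeff_def)
qed

text \<open>Both terms acquire the factor \<open>1 / T\<close>: the time derivative directly, the
  diffusion because \<open>T powr \<beta> / r^2 = 1 / T\<close>. Replacing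
  \<open>t powr \<beta>\<close> by \<open>T powr \<beta>\<close> is legitimate on the support, where
  \<open>t \<le> T\<close>; off it the bound on the Laplacian is zero.\<close>

lemma operator_cutoff_bound:
  fixes x :: "'n::finite heisenberg" and m :: nat
  defines "k \<equiv> Suc (Suc (Suc m))"
  assumes a: "0 < a" "a \<le> C * t powr \<beta>"
    and "0 \<le> \<beta>" "0 < t" "0 < T" "0 < r" and r: "r^2 = T powr (1 + \<beta>)"
  shows "- (v * time_deriv (cutoff k r T) (x, t)) - a * v * kohn_laplacian (\<lambda>y. cutoff k r T (y, t)) x
    \<le> (real k + 92 * real CARD('n) * real k ^ 2 * C) / T * \<bar>v\<bar> * max 0 (1 - t / T - heis_gauge r x) ^ Suc m"
proof -
  let ?w = "max 0 (1 - t / T - heis_gauge r x)"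
  let ?L = "92 * real CARD('n) * real k ^ 2"
  have "0 \<le> t / T" using assms by simp
  then have w1: "?w \<le> 1" using heis_gauge_nonneg[of r x] by (auto simp: max_def)
  have C: "0 \<le> C" using a \<open>0 < t\<close> by (smt (verit) mult_nonpos_nonneg powr_ge_zero)
  have evo: "- (v * time_deriv (cutoff k r T) (x, t)) \<le> real k / T * \<bar>v\<bar> * ?w ^ Suc m"
  proof -
    have "- (v * time_deriv (cutoff k r T) (x, t)) = v * (real k / T * ?w ^ Suc (Suc m))"
      unfolding k_def using time_deriv_cutoff(1)[of "(x, t)" "Suc m" r T] \<open>0 < t\<close>
      by (simp del: power_Suc of_nat_Suc)
    also have "\<dots> \<le> \<bar>v\<bar> * (real k / T * ?w ^ Suc m)"
      using w1 assms(6) by (intro mult_mono mult_left_mono power_decreasing) auto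
    finally show ?thesis by (simp add: mult_ac)
  qed
  have dif: "- (a * v * kohn_laplacian (\<lambda>y. cutoff k r T (y, t)) x) \<le> ?L * C / T * \<bar>v\<bar> * ?w ^ Suc m"
  proof (cases "?w = 0")
    case True
    with kohn_laplacian_cutoff_bound[OF \<open>0 < r\<close> \<open>0 < T\<close>, of t m x] \<open>0 < t\<close> show ?thesis
      by (simp add: k_def)
  next
    case False
    then have "t / T \<le> 1" using heis_gauge_nonneg[of r x] by (auto simp: max_def split: if_splits)
    then have "t \<le> T" using assms by simp
    then have "t powr \<beta> \<le> T powr \<beta>" using assms by (intro powr_mono2) auto
    then have aT: "a \<le> C * T powr \<beta>" using a C by (meson mult_left_mono order_trans)
    have "- (a * v * kohn_laplacian (\<lambda>y. cutoff k r T (y, t)) x)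
      \<le> \<bar>a * v * kohn_laplacian (\<lambda>y. cutoff k r T (y, t)) x\<bar>" by simp
    also have "\<dots> = a * \<bar>v\<bar> * \<bar>kohn_laplacian (\<lambda>y. cutoff k r T (y, t)) x\<bar>"
      using a by (simp add: abs_mult)
    also have "\<dots> \<le> (C * T powr \<beta>) * \<bar>v\<bar> * (?L / r^2 * ?w ^ Suc m)"
      using aT a C kohn_laplacian_cutoff_bound[OF \<open>0 < r\<close> \<open>0 < T\<close>, of t m x] \<open>0 < t\<close>
      unfolding k_def by (intro mult_mono mult_nonneg_nonneg) auto
    also have "\<dots> = ?L * C / T * \<bar>v\<bar> * ?w ^ Suc m"
      unfolding r using \<open>0 < T\<close> by (simp add: powr_add field_simps del: power_Suc)
    finally show ?thesis .
  qed
  have "(real k + ?L * C) / T * \<bar>v\<bar> * ?w ^ Suc m =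
    real k / T * \<bar>v\<bar> * ?w ^ Suc m + ?L * C / T * \<bar>v\<bar> * ?w ^ Suc m"
    by (simp add: add_divide_distrib distrib_right)
  with evo dif show ?thesis by linarith
qed

text \<open>In the weak formulation the nonnegative initial term is dropped. The pointwise Young
  bound leaves half of the source on the right, whence the outer factor 2, and a constant that is
  integrated over the box only.\<close>

lemma cutoff_energy_bound:
  fixes u :: "'n::finite heisenberg \<times> real \<Rightarrow> real" and m :: nat
  defines "k \<equiv> Suc (Suc (Suc m))"
  assumes ws: "weak_solution M p u0 u"
    and M: "\<And>t a b. 0 < t \<Longrightarrow> 0 \<le> a \<Longrightarrow> 0 \<le> b \<Longrightarrow> 0 < M t a b \<and> M t a b \<le> C * t powr \<beta>"
    and p: "1 < p" "real k / p \<le> real (Suc m)" and "0 \<le> \<beta>" "0 < T" "0 < r"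
    and r: "r^2 = T powr (1 + \<beta>)"
  shows "set_integrable lebesgue Omega (\<lambda>z. \<bar>u z\<bar> powr p * cutoff k r T z)" (is ?I)
    and "(LINT z:Omega|lebesgue. \<bar>u z\<bar> powr p * cutoff k r T z) \<le>
      2 * (2 * ((real k + 92 * real CARD('n) * real k ^ 2 * C) / T)) powr (p / (p - 1)) *
      measure lebesgue (support_box r T :: ('n heisenberg \<times> real) set)" (is ?E)
proof -
  let ?\<phi> = "cutoff k r T :: 'n heisenberg \<times> real \<Rightarrow> real"
  let ?box = "support_box r T :: ('n heisenberg \<times> real) set"
  let ?src = "\<lambda>z. \<bar>u z\<bar> powr p * ?\<phi> z"
  let ?ini = "\<lambda>x. u0 x * ?\<phi> (x, 0)"
  let ?evo = "\<lambda>z. u z * time_deriv ?\<phi> z"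
  let ?dif = "\<lambda>(x, t). kirchhoff_coeff M u t * u (x, t) * kohn_laplacian (\<lambda>y. ?\<phi> (y, t)) x"
  let ?A = "(real k + 92 * real CARD('n) * real k ^ 2 * C) / T"
  let ?B = "(2 * ?A) powr (p / (p - 1))"
  have \<phi>0: "0 \<le> ?\<phi> z" for z by (simp add: cutoff_def)
  have tf: "test_function_21 ?\<phi>"
    unfolding k_def using assms by (intro test_function_21_cutoff)
  have I: "set_integrable lebesgue Omega ?src" "set_integrable lebesgue Omega ?evo"
      "set_integrable lebesgue Omega ?dif"
    and eq: "(LINT z:Omega|lebesgue. ?src z) + (\<integral>x. ?ini x \<partial>lebesgue) =
      - (LINT z:Omega|lebesgue. ?evo z) - (LINT z:Omega|lebesgue. ?dif z)"
    and u0: "AE x in lebesgue. 0 \<le> u0 x"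
    using ws tf \<phi>0 unfolding weak_solution_def Let_def by blast+
  show ?I by (rule I(1))
  \<comment> \<open>At \<open>t = 1\<close> the power of \<open>t\<close> is 1, which reveals the
    sign of \<open>C\<close>.\<close>
  have "0 < M 1 0 0 \<and> M 1 0 0 \<le> C" using M[of 1 0 0] by simp
  then have C: "0 \<le> C" by linarith
  then have A: "0 \<le> ?A" using assms by simp
  have pw: "- ?evo z - ?dif z \<le> ?src z / 2 + ?B * indicator ?box z" if "z \<in> Omega" for z
  proof -
    obtain x t where z: "z = (x, t)" by fastforce
    then have t: "0 < t" using that by (auto simp: Omega_def)
    let ?w = "max 0 (1 - t / T - heis_gauge r x)"
    have "0 \<le> t / T" using assms t by simp
    then have w1: "?w \<le> 1" using heis_gauge_nonneg[of r x] by (auto simp: max_def)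
    have op: "- ?evo z - ?dif z \<le> ?A * \<bar>u z\<bar> * ?w ^ Suc m"
      using operator_cutoff_bound[OF kirchhoff_coeff_bounds[OF M t], where v="u z" and x=x and T=T and r=r and m=m]
        assms t by (simp add: z k_def del: power_Suc)
    show ?thesis
    proof (cases "?w = 0")
      case True
      have "0 \<le> ?src z / 2 + ?B * indicator ?box z" using \<phi>0 by simp
      with op True show ?thesis by simp
    next
      case False
      then have "0 < 1 - snd z / T - heis_gauge r (fst z)" by (simp add: z max_def split: if_splits)
      then have "z \<in> ?box" using assms t z by (intro support_boxI) auto
      moreover have "?A * \<bar>u z\<bar> * ?w ^ Suc m \<le> \<bar>u z\<bar> powr p * ?w ^ k / 2 + ?B"
        using p A w1 by (intro weighted_young) (auto simp: k_def)
      ultimately show ?thesis using op by (simp add: cutoff_def z del: power_Suc)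
    qed
  qed
  have box: "integrable lebesgue (indicator ?box :: _ \<Rightarrow> real)"
    using emeasure_lborel_cbox_finite by (simp add: support_box_def integrable_indicator_iff)
  have "0 \<le> (\<integral>x. ?ini x \<partial>lebesgue)"
    using u0 \<phi>0 by (intro integral_nonneg_AE) (auto elim!: eventually_mono)
  with eq have "(LINT z:Omega|lebesgue. ?src z) \<le>
      - (LINT z:Omega|lebesgue. ?evo z) - (LINT z:Omega|lebesgue. ?dif z)" by linarith
  also have "\<dots> = (\<integral>z. - (indicator Omega z *\<^sub>R ?evo z) - indicator Omega z *\<^sub>R ?dif z \<partial>lebesgue)"
    using I unfolding set_integrable_def set_lebesgue_integral_def by simp
  also have "\<dots> \<le> (\<integral>z. (indicator Omega z *\<^sub>R ?src z) / 2 + ?B * indicator ?box z \<partial>lebesgue)"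
  proof (rule integral_mono)
    fix z :: "'n heisenberg \<times> real"
    show "- (indicator Omega z *\<^sub>R ?evo z) - indicator Omega z *\<^sub>R ?dif z
      \<le> (indicator Omega z *\<^sub>R ?src z) / 2 + ?B * indicator ?box z"
      using pw[of z] by (cases "z \<in> Omega") auto
  qed (use I box in \<open>auto simp: set_integrable_def\<close>)
  also have "\<dots> = (LINT z:Omega|lebesgue. ?src z) / 2 + ?B * measure lebesgue ?box"
    using I(1) box unfolding set_integrable_def set_lebesgue_integral_def
    by (subst Bochner_Integration.integral_add) auto
  finally show ?E by simp
qed

section \<open>Growing cutoffs and the limit of large T\<close>

lemma cutoff_mono:
  assumes "0 < S" "S \<le> T" "0 < q" "0 \<le> snd z"
  shows "cutoff k (S powr q) S z \<le> cutoff k (T powr q) T z"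
proof -
  have r: "0 < S powr q" "S powr q \<le> T powr q" using assms by (auto intro: powr_mono2)
  then have "(S powr q) ^ j \<le> (T powr q) ^ j" for j by (intro power_mono) auto
  then have "heis_gauge (T powr q) (fst z) \<le> heis_gauge (S powr q) (fst z)"
    unfolding heis_gauge_def using r by (intro add_mono divide_left_mono mult_pos_pos zero_less_power) auto
  moreover have "snd z / T \<le> snd z / S" using assms by (intro divide_left_mono) auto
  ultimately show ?thesis unfolding cutoff_def by (intro power_mono max.mono) auto
qed

lemma eventually_cutoff_pos:
  assumes "0 < q"
  shows "eventually (\<lambda>T. 0 < cutoff k (T powr q) T z) at_top"
proof -
  have q: "filterlim (\<lambda>T::real. T powr q) at_top at_top"
  proof -
    have "filterlim (\<lambda>T. exp (q * ln T)) at_top at_top"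
      by (intro filterlim_compose[OF exp_at_top]
          filterlim_tendsto_pos_mult_at_top[OF tendsto_const assms] ln_at_top)
    then show ?thesis
      by (rule filterlim_mono_eventually)
        (auto simp: powr_def intro: eventually_mono[OF eventually_gt_at_top[of 0]])
  qed
  have pw: "filterlim (\<lambda>T::real. (T powr q) ^ j) at_infinity at_top" if "0 < j" for j
    using that by (intro filterlim_at_top_imp_at_infinity filterlim_pow_at_top q)
  have "((\<lambda>T. 1 - snd z / T - heis_gauge (T powr q) (fst z)) \<longlongrightarrow> 1 - 0 - (0 + 0)) at_top"
    unfolding heis_gauge_def
    by (intro tendsto_diff tendsto_add tendsto_const tendsto_divide_0[OF tendsto_const] pw
        filterlim_at_top_imp_at_infinity filterlim_ident) auto
  then have "eventually (\<lambda>T. 0 < 1 - snd z / T - heis_gauge (T powr q) (fst z)) at_top"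
    by (rule order_tendstoD) simp
  then show ?thesis by eventually_elim (simp add: cutoff_def)
qed

text \<open>With \<open>r^2 = T powr (1 + \<beta>)\<close> the box has volume of order
  \<open>T powr ((n + 1) * (1 + \<beta>) + 1)\<close>, where n is \<open>CARD('n)\<close>. Against
  \<open>T powr (- p / (p - 1))\<close> there remains the exponent \<open>e\<close> below, and
  \<open>sub\<close> says that it is negative.\<close>

lemma weak_solution_trivial:
  fixes u :: "'n::finite heisenberg \<times> real \<Rightarrow> real"
  assumes ws: "weak_solution M p u0 u"
    and M: "\<And>t a b. 0 < t \<Longrightarrow> 0 \<le> a \<Longrightarrow> 0 \<le> b \<Longrightarrow> 0 < M t a b \<and> M t a b \<le> C * t powr \<beta>"
    and p: "1 < p" and \<beta>: "0 \<le> \<beta>"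
    and sub: "(real CARD('n) + 1) * (1 + \<beta>) < 1 / (p - 1)"
  shows "AE z in lebesgue. z \<in> Omega \<longrightarrow> u z = 0"
proof -
  define q where "q = (1 + \<beta>) / 2"
  have q: "0 < q" using \<beta> by (simp add: q_def)
  \<comment> \<open>This gives \<open>m * (p - 1) \<ge> 3\<close>, hence
    \<open>p * (m + 1) = m + m * (p - 1) + p \<ge> m + 3 = k\<close>, the condition of the weighted
    Young inequality.\<close>
  define m where "m = nat \<lceil>3 / (p - 1)\<rceil>"
  define k where "k = Suc (Suc (Suc m))"
  have "3 / (p - 1) \<le> real m" by (simp add: m_def real_nat_ceiling_ge)
  then have "3 \<le> real m * (p - 1)" using p by (simp add: divide_le_eq)
  then have k: "real k / p \<le> real (Suc m)" using p by (simp add: k_def divide_le_eq algebra_simps)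
  define S where "S T = (LINT z:Omega|lebesgue. \<bar>u z\<bar> powr p * cutoff k (T powr q) T z)" for T
  let ?A = "real k + 92 * real CARD('n) * real k ^ 2 * C"
  define D where "D = 2 * (2 * ?A) powr (p / (p - 1)) * 2 ^ (2 * CARD('n) + 1)"
  define e where "e = (real CARD('n) + 1) * (1 + \<beta>) - 1 / (p - 1)"
  have "0 < M 1 0 0 \<and> M 1 0 0 \<le> C" using M[of 1 0 0] by simp
  then have A: "0 \<le> ?A" by simp
  have rT: "(T powr q)^2 = T powr (1 + \<beta>)" "0 < T powr q" if "0 < T" for T
    using that by (simp_all add: q_def powr_powr add_divide_distrib flip: powr_realpow)
  have int: "set_integrable lebesgue Omega (\<lambda>z. \<bar>u z\<bar> powr p * cutoff k (T powr q) T z)" if "0 < T" for T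
    unfolding k_def using that rT[OF that] p \<beta> k
    by (intro cutoff_energy_bound(1)[OF ws M]) (auto simp: k_def)
  have S_le: "S T \<le> D * T powr e" if T: "0 < T" for T
  proof -
    have "S T \<le> 2 * (2 * (?A / T)) powr (p / (p - 1)) *
        measure lebesgue (support_box (T powr q) T :: ('n heisenberg \<times> real) set)"
      unfolding S_def k_def using rT[OF T] p \<beta> k T
      by (intro cutoff_energy_bound(2)[OF ws M]) (auto simp: k_def)
    also have "\<dots> = D * (T powr - (p / (p - 1)) * T powr (q * real (2 * CARD('n) + 2)) * T powr 1)"
    proof -
      have "(2 * (?A / T)) powr (p / (p - 1)) = (2 * ?A) powr (p / (p - 1)) * T powr - (p / (p - 1))"
        using A T powr_divide[of "2 * ?A" T "p / (p - 1)"]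
        by (simp only: mult.assoc powr_minus divide_inverse)
      moreover have "(T powr q) ^ (2 * CARD('n) + 2) = T powr (q * real (2 * CARD('n) + 2))"
        using powr_realpow[OF rT(2)[OF T], of "2 * CARD('n) + 2"] by (simp only: powr_powr)
      ultimately show ?thesis
        using T measure_support_box[OF rT(2)[OF T] T, where 'n='n] by (simp add: D_def)
    qed
    also have "\<dots> = D * T powr (- (p / (p - 1)) + q * real (2 * CARD('n) + 2) + 1)"
      by (simp only: powr_add)
    also have "- (p / (p - 1)) + q * real (2 * CARD('n) + 2) + 1 = e"
      using p by (simp add: e_def q_def field_simps)
    finally show ?thesis .
  qed
  have "e < 0" using sub by (simp add: e_def)
  then have "((\<lambda>T. D * T powr e) \<longlongrightarrow> D * 0) at_top"
    by (intro tendsto_mult tendsto_const tendsto_neg_powr filterlim_ident)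
  then have lim: "((\<lambda>T. D * T powr e) \<longlongrightarrow> 0) at_top" by simp
  have vanish: "AE z in lebesgue. z \<in> Omega \<longrightarrow> \<bar>u z\<bar> powr p * cutoff k (T powr q) T z = 0" if T: "0 < T" for T
  proof -
    have mono: "S T \<le> S T'" if "T \<le> T'" for T'
    proof -
      have "0 < T'" using T that by simp
      then show ?thesis
        unfolding S_def using int T q that
        by (intro set_integral_mono mult_left_mono cutoff_mono) (auto simp: Omega_def)
    qed
    \<comment> \<open>With \<open>T\<close> fixed and \<open>T'\<close> growing, monotonicity makes
      \<open>S T\<close> a lower bound for a quantity that tends to 0.\<close>
    have "eventually (\<lambda>T'. S T \<le> D * T' powr e) at_top"
      using eventually_ge_at_top[of T]
    proof eventually_elim
      case (elim T')
      then show ?case using mono[of T'] S_le[of T'] T by simp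
    qed
    then have "S T \<le> 0"
      using lim by (intro tendsto_lowerbound) auto
    moreover have "0 \<le> indicator Omega z *\<^sub>R (\<bar>u z\<bar> powr p * cutoff k (T powr q) T z)" for z
      by (simp add: cutoff_def)
    moreover from this have "0 \<le> S T"
      unfolding S_def set_lebesgue_integral_def by (rule Bochner_Integration.integral_nonneg)
    ultimately have "AE z in lebesgue. indicator Omega z *\<^sub>R (\<bar>u z\<bar> powr p * cutoff k (T powr q) T z) = 0"
      using int[OF T] integral_nonneg_eq_0_iff_AE[of lebesgue "\<lambda>z. indicator Omega z *\<^sub>R (\<bar>u z\<bar> powr p * cutoff k (T powr q) T z)"]
      by (simp only: S_def set_lebesgue_integral_def set_integrable_def order_antisym_conv) simp
    then show ?thesis by eventually_elim auto
  qed
  \<comment> \<open>Integer values of \<open>T\<close> suffice to exhaust Omega and keep the union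
    of the null sets countable; \<open>Suc j\<close> avoids \<open>T = 0\<close>.\<close>
  have "AE z in lebesgue. \<forall>j. z \<in> Omega \<longrightarrow>
      \<bar>u z\<bar> powr p * cutoff k (real (Suc j) powr q) (real (Suc j)) z = 0"
    unfolding AE_all_countable by (intro allI vanish) simp
  then show ?thesis
  proof eventually_elim
    case (elim z)
    have "eventually (\<lambda>j. 0 < cutoff k (real (Suc j) powr q) (real (Suc j)) z) sequentially"
      using eventually_cutoff_pos[OF q, of k z]
        filterlim_compose[OF filterlim_real_sequentially filterlim_Suc]
      by (rule eventually_compose_filterlim)
    then obtain j where "0 < cutoff k (real (Suc j) powr q) (real (Suc j)) z"
      using eventually_happens'[OF sequentially_bot] by blast
    with elim show ?case by (metis less_irrefl mult_eq_0_iff powr_eq_0_iff abs_eq_0)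
  qed
qed

section \<open>The subcritical range and the nonexistence result\<close>

theorem theorem3p2:
  fixes M :: "real \<Rightarrow> real \<Rightarrow> real \<Rightarrow> real" and C\<^sub>1 \<beta> p Q :: real
  assumes "Q = 2 * real CARD('n::finite) + 2"
    and "0 \<le> \<beta>" and "\<beta> < 1"
    and "\<And>t a b. 0 < t \<Longrightarrow> 0 \<le> a \<Longrightarrow> 0 \<le> b \<Longrightarrow> 0 < M t a b \<and> M t a b \<le> C\<^sub>1 * t powr \<beta>"
    and "1 < p" and "p < 1 + (2 - 2 * \<beta>) / (Q + 2 * \<beta>)"
  shows "\<not> (\<exists>(u0 :: 'n heisenberg \<Rightarrow> real) (u :: 'n heisenberg \<times> real \<Rightarrow> real).
           weak_solution M p u0 u \<and> nontrivial u)"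
proof -
  have Q: "0 < Q" using assms(1) by simp
  have "(p - 1) * (Q + 2 * \<beta>) < 2 - 2 * \<beta>"
    using assms(2,6) Q by (simp add: field_simps)
  \<comment> \<open>The aim is \<open>(p - 1) * Q * (1 + \<beta>) < 2\<close>, which is
    \<open>sub\<close> because \<open>Q = 2 * (n + 1)\<close>. It is proved after multiplication by
    \<open>1 - \<beta> > 0\<close>, where \<open>(1 + \<beta>) * (1 - \<beta>) \<le> 1\<close>
    permits comparison with the hypothesis on \<open>p\<close>.\<close>
  moreover have "(p - 1) * (Q * (1 + \<beta>) * (1 - \<beta>)) \<le> (p - 1) * (Q + 2 * \<beta>)"
  proof (rule mult_left_mono)
    have "Q * (1 + \<beta>) * (1 - \<beta>) = Q - Q * (\<beta> * \<beta>)" by (simp add: algebra_simps)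
    also have "\<dots> \<le> Q + 2 * \<beta>" using Q assms(2) by (simp add: order_trans[of _ 0])
    finally show "Q * (1 + \<beta>) * (1 - \<beta>) \<le> Q + 2 * \<beta>" .
  qed (use assms(5) in simp)
  ultimately have "(p - 1) * (Q * (1 + \<beta>)) * (1 - \<beta>) < 2 * (1 - \<beta>)"
    by (simp add: mult.assoc)
  then have "(p - 1) * (Q * (1 + \<beta>)) < 2"
    using assms(3) by (simp only: mult_less_cancel_right)
  then have sub: "(real CARD('n) + 1) * (1 + \<beta>) < 1 / (p - 1)"
    using assms(1,5) by (simp add: field_simps)
  show ?thesis
  proof (rule notI, elim exE conjE)
    fix u0 :: "'n heisenberg \<Rightarrow> real" and u :: "'n heisenberg \<times> real \<Rightarrow> real"
    assume ws: "weak_solution M p u0 u" and "nontrivial u"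
    moreover have "AE z in lebesgue. z \<in> Omega \<longrightarrow> u z = 0"
      by (rule weak_solution_trivial[OF ws _ assms(5,2) sub]) (rule assms(4))
    ultimately show False by (simp add: nontrivial_def)
  qed
qed

end
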